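(* Let $r\ge 1$ and let $G$ be an $r$-regular graph on $n=2r$ vertices. Then for every real number $p\geq3$, $$\mathcal{E}_p(S(G)) \le (n-1)^p + (n-1),$$ with equality if and only if $G\cong K_{r,r}$.
   Context: All graphs are finite, simple, undirected, non-empty and have at least one edge. A graph is $r$-regular if every vertex has degree $r$. $K_{a,b}$ denotes the complete bipartite graph with parts of sizes $a$ and $b$. For a graph $G$ with vertex set $\{v_1,\dots,v_n\}$, the Seidel matrix $S(G)$ is the real symmetric $n\times n$ matrix with zero diagonal whose $(i,j)$-entry, for $i\neq j$, is $-1$ if $v_i$ and $v_j$ are adjacent and $+1$ otherwise. If $\lambda_1,\dots,\lambda_n$ are the eigenvalues of $S(G)$ (with multiplicity), the $p$-Seidel energy is $\mathcal{E}_p(S(G))=\sum_{i=1}^n|\lambda_i|^p$ for $p>0$. *)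

theory Defs
  imports
    "Graph_Theory.Graph_Theory"
    "Jordan_Normal_Form.Char_Poly"
    "HOL-Computational_Algebra.Polynomial"
    Complex_Main
begin

text \<open>
  Finite simple undirected graphs are the library's \<^locale>\<open>graph\<close>s: finite, loop-free,
  symmetric digraphs without parallel arcs. Each edge is a pair of opposite arcs, so the degree
  of a vertex is its out-degree (equivalently, its in-degree).
\<close>

definition regular_graph :: "nat \<Rightarrow> ('a, 'b) pre_digraph \<Rightarrow> bool" where
  "regular_graph r G \<longleftrightarrow> graph G \<and> (\<forall>v\<in>verts G. out_degree G v = r)"

text \<open>
  The list \<open>vs\<close> is the enumeration \<open>v\<^sub>1, \<dots>, v\<^sub>n\<close> of the vertex set that indexes the
  rows and columns; it is meant to satisfy \<open>distinct vs\<close> and \<open>set vs = verts G\<close>.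
\<close>

definition seidel_matrix :: "('a, 'b) pre_digraph \<Rightarrow> 'a list \<Rightarrow> real mat" where
  "seidel_matrix G vs = mat (length vs) (length vs)
     (\<lambda>(i, j). if i = j then 0 else if (vs ! i, vs ! j) \<in> arcs_ends G then -1 else 1)"

text \<open>
  The eigenvalues with multiplicity are the roots of the characteristic polynomial. Taking only
  its real roots loses nothing for the matrices above: they are real symmetric, so their
  characteristic polynomials split over the reals and algebraic and geometric multiplicities
  agree.
\<close>

definition seidel_energy :: "real \<Rightarrow> ('a, 'b) pre_digraph \<Rightarrow> 'a list \<Rightarrow> real" where
  "seidel_energy p G vs = (\<Sum>x\<in>#proots (char_poly (seidel_matrix G vs)). \<bar>x\<bar> powr p)"

end

theory Submission
  imports Defs "Jordan_Normal_Form.Schur_Decomposition" "HOL-Analysis.Convex"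
begin

text \<open>
  Put \<open>N = n - 1\<close>. The Seidel matrix has zero diagonal and entries \<open>\<plusminus>1\<close> elsewhere, so its eigenvalues
  \<open>\<lambda>\<close> satisfy \<open>\<Sum>\<lambda> = 0\<close> and \<open>\<Sum>\<lambda>\<^sup>2 = N (N + 1)\<close> (traces of \<open>S\<close> and \<open>S\<^sup>2\<close>) and
  \<open>\<bar>\<lambda>\<bar> \<le> N\<close> (largest entry of an eigenvector). If some \<open>\<bar>\<lambda>\<bar>\<close> equals \<open>N\<close>, then off the diagonal
  \<open>S\<close> agrees with \<open>s s\<^sup>T\<close> or \<open>- s s\<^sup>T\<close> for a sign vector \<open>s\<close>. So the graph is complete
  bipartite or a union of two cliques (one of the two parts may be empty), and an
  \<open>r\<close>-regular graph on \<open>2 r \<ge> 4\<close> vertices can only be the former (\<open>complete_bipartite_if_extremal_eigenvalue\<close>).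

  For \<open>K\<^bsub>r,r\<^esub>\<close> the number \<open>N\<close> is an eigenvalue, and the two moments then give
  \<open>\<Sum>(\<lambda> + 1)\<^sup>2 = 0\<close> over the remaining ones. Hence these all are \<open>-1\<close> and equality holds
  (\<open>power_sum_rank_one_spectrum\<close>).

  For every other graph \<open>r \<ge> 3\<close>, as the cases \<open>r = 1\<close> and \<open>r = 2\<close> only allow \<open>K\<^bsub>r,r\<^esub>\<close>, and all
  \<open>\<bar>\<lambda>\<bar>\<close> are smaller than \<open>N\<close>. The strict inequality is now a fact about real numbers with these
  moments. The cubic case \<open>\<Sum>\<bar>\<lambda>\<bar>\<^sup>3 < N\<^sup>3 + N\<close> is \<open>abs_cube_sum_less\<close>: a drop of the largest
  modulus below \<open>N\<close> costs more than the others can gain from the squares that it sets free. The case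
  of an exponent \<open>p \<ge> 3\<close> follows from the cubic one (\<open>power_sum_less_from_cubic\<close>), because on
  \<open>[0, N]\<close> the function \<open>t\<^sup>p\<close> lies below some \<open>a + b t\<^sup>2 + c t\<^sup>3\<close> with \<open>c > 0\<close> that
  agrees with it at \<open>1\<close> and \<open>N\<close>, the moduli occurring for \<open>K\<^bsub>r,r\<^esub>\<close>.
\<close>

section \<open>Power sums with prescribed first and second moments\<close>

text \<open>
  The coefficients are those for which the difference \<open>h\<close> of the two sides has a double zero at \<open>1\<close>
  and a zero at \<open>N\<close>. If \<open>p > 3\<close>, Descartes' rule of signs for real exponents says that such an \<open>h\<close>,
  built from the exponents \<open>0, 2, 3, p\<close>, changes sign on the positive axis only at \<open>N\<close>; if \<open>p = 3\<close>,
  it vanishes identically. The proof makes this concrete: \<open>h' t = t * g t\<close> with \<open>g\<close> convex,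
  and \<open>g\<close> vanishes at \<open>1\<close> and at a point between \<open>1\<close> and \<open>N\<close>, so its sign is known everywhere.
\<close>
lemma powr_le_cubic_touching_at_1:
  fixes N p :: real
  assumes N: "N > 1" and p: "p \<ge> 3"
  obtains a b c :: real where "c > 0" and "a + b + c = 1" and "a + b * N^2 + c * N^3 = N powr p"
    and "\<And>t. 0 \<le> t \<Longrightarrow> t \<le> N \<Longrightarrow> t powr p \<le> a + b * t^2 + c * t^3"
proof -
  \<comment> \<open>The solution of \<open>h 1 = h' 1 = h N = 0\<close>; the denominator is \<open>N\<^sup>3 - 1 - 3/2 * (N\<^sup>2 - 1)\<close>.\<close>
  define c where "c = (N powr p - 1 - p/2 * (N^2 - 1)) / ((N - 1)^2 * (2*N + 1) / 2)"
  define b where "b = (p - 3 * c) / 2"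
  have b2: "2 * b = p - 3 * c" by (simp add: b_def)
  define a where "a = 1 - b - c"
  define h where "h t = t powr p - (a + b * t^2 + c * t^3)" for t
  define g where "g t = p * t powr (p-2) - 2 * b - 3 * c * t" for t
  have h1: "h 1 = 0" by (simp add: h_def a_def)
  have "c * ((N - 1)^2 * (2*N + 1) / 2) = N powr p - 1 - p/2 * (N^2 - 1)"
    using N by (simp add: c_def)
  then have aN: "a + b * N^2 + c * N^3 = N powr p"
    unfolding a_def b_def by (simp add: field_simps power2_eq_square power3_eq_cube)
  then have hN: "h N = 0" by (simp add: h_def)
  have deriv: "(h has_real_derivative t * g t) (at t)" if "t > 0" for t
  proof -
    have "t * t powr (p-2) = t powr (p-1)"
      using that by (simp add: powr_mult_base)
    then show ?thesis
      unfolding h_def g_def using that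
      by (auto intro!: derivative_eq_intros simp: algebra_simps power2_eq_square)
  qed
  have cont: "continuous_on {0..N} h"
    unfolding h_def using p by (intro continuous_intros continuous_on_powr') auto
  obtain \<xi> where \<xi>: "1 < \<xi>" "\<xi> < N" "\<xi> * g \<xi> = 0"
  proof -
    have "\<exists>z>1. z < N \<and> h N - h 1 = (N - 1) * (z * g z)"
      using N deriv by (intro MVT2) auto
    with h1 hN N that show thesis by auto
  qed
  have g1: "g 1 = 0" by (simp add: g_def b2)
  have g\<xi>: "g \<xi> = 0" using \<xi> by simp
  have "c > 0"
  proof -
    have "3 * c * (\<xi> - 1) = p * (\<xi> powr (p-2) - 1)"
      using g\<xi> b2 by (simp add: g_def algebra_simps)
    moreover have "p * (\<xi> powr (p-2) - 1) > 0"
      using \<xi> p by (simp add: gr_one_powr)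
    ultimately show ?thesis using \<xi> by (metis diff_gt_0_iff_gt zero_less_mult_iff zero_less_numeral linorder_not_less mult_nonpos_nonneg less_eq_real_def)
  qed
  have conv: "convex_on {0<..} (\<lambda>t. t powr (p-2))" using p by (intro powr_convex) auto
  \<comment> \<open>Convexity of \<open>g\<close>, free of divisions: only the power term matters, the rest of \<open>g\<close> is affine.\<close>
  have three: "g y * (z - x) \<le> (z - y) * g x + (y - x) * g z" if xyz: "0 < x" "x < y" "y < z" for x y z
  proof -
    have "(x powr (p-2) - y powr (p-2)) / (x - y) \<le> (x powr (p-2) - z powr (p-2)) / (x - z)"
      using convex_on_slope_le(1)[OF conv, of x z y] xyz by simp
    then have "y powr (p-2) * (z - x) \<le> (z - y) * x powr (p-2) + (y - x) * z powr (p-2)"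
      using xyz by (simp add: divide_simps) (simp add: algebra_simps)
    then have "p * (y powr (p-2) * (z - x)) \<le> p * ((z - y) * x powr (p-2) + (y - x) * z powr (p-2))"
      using p by (intro mult_left_mono) auto
    then show ?thesis by (simp add: g_def algebra_simps)
  qed
  have neg: "g t \<le> 0" if "1 < t" "t < \<xi>" for t
    using three[of 1 t \<xi>] that g1 g\<xi> \<xi> by (simp add: mult_le_0_iff)
  have posr: "g t \<ge> 0" if "\<xi> < t" for t
    using three[of 1 \<xi> t] that g1 g\<xi> \<xi> by (simp add: zero_le_mult_iff)
  have posl: "g t \<ge> 0" if "0 < t" "t < 1" for t
    using three[of t 1 \<xi>] that g1 g\<xi> \<xi> by (simp add: zero_le_mult_iff)
  have "h t \<le> 0" if t: "0 \<le> t" "t \<le> N" for t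
  proof -
    consider "t \<le> 1" | "1 \<le> t" "t \<le> \<xi>" | "\<xi> \<le> t" by linarith
    then show ?thesis
    proof cases
      case 1
      have "h t \<le> h 1"
      proof (rule DERIV_nonneg_imp_increasing_open[OF 1])
        show "\<exists>y. (h has_real_derivative y) (at x) \<and> 0 \<le> y" if "t < x" "x < 1" for x
          using deriv[of x] posl[of x] that t by (intro exI[of _ "x * g x"]) simp
      qed (rule continuous_on_subset[OF cont], use t N in auto)
      then show ?thesis by (simp add: h1)
    next
      case 2
      have "h t \<le> h 1"
      proof (rule DERIV_nonpos_imp_decreasing_open[OF 2(1)])
        show "\<exists>y. (h has_real_derivative y) (at x) \<and> y \<le> 0" if "1 < x" "x < t" for x
          using deriv[of x] neg[of x] that 2 by (intro exI[of _ "x * g x"]) (simp add: mult_le_0_iff)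
      qed (rule continuous_on_subset[OF cont], use t N in auto)
      then show ?thesis by (simp add: h1)
    next
      case 3
      have "h t \<le> h N"
      proof (rule DERIV_nonneg_imp_increasing_open[OF t(2)])
        show "\<exists>y. (h has_real_derivative y) (at x) \<and> 0 \<le> y" if "t < x" "x < N" for x
          using deriv[of x] posr[of x] that 3 \<xi> by (intro exI[of _ "x * g x"]) simp
      qed (rule continuous_on_subset[OF cont], use t N in auto)
      then show ?thesis by (simp add: hN)
    qed
  qed
  then have "\<And>t. 0 \<le> t \<Longrightarrow> t \<le> N \<Longrightarrow> t powr p \<le> a + b * t^2 + c * t^3"
    by (simp add: h_def)
  moreover have "a + b + c = 1" by (simp add: a_def)
  ultimately show thesis using that \<open>c > 0\<close> aN by blast
qed

text \<open>
  Sum the pointwise bound over \<open>M\<close>. The moments \<open>0\<close> and \<open>2\<close> and the cubic bound are those of the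
  multiset consisting of \<open>N\<close> and of \<open>N\<close> copies of \<open>1\<close>, where the pointwise bound is an equality.
\<close>
lemma power_sum_less_from_cubic:
  fixes M :: "real multiset" and N p :: real
  assumes N: "N > 1" and p: "p \<ge> 3" and size: "real (size M) = N + 1"
    and sq: "(\<Sum>x\<in>#M. x^2) = N * (N + 1)"
    and le: "\<And>x. x \<in># M \<Longrightarrow> \<bar>x\<bar> \<le> N"
    and cubic: "(\<Sum>x\<in>#M. \<bar>x\<bar>^3) < N^3 + N"
  shows "(\<Sum>x\<in>#M. \<bar>x\<bar> powr p) < N powr p + N"
proof -
  from powr_le_cubic_touching_at_1[OF N p] obtain a b c :: real where c: "c > 0" and one: "a + b + c = 1"
    and top: "a + b * N^2 + c * N^3 = N powr p"
    and le': "\<And>t. 0 \<le> t \<Longrightarrow> t \<le> N \<Longrightarrow> t powr p \<le> a + b * t^2 + c * t^3" by metis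
  have "(\<Sum>x\<in>#M. \<bar>x\<bar> powr p) \<le> (\<Sum>x\<in>#M. a + b * x^2 + c * \<bar>x\<bar>^3)"
    using le'[of "\<bar>_\<bar>"] le by (intro sum_mset_mono) (force simp: power2_abs)
  also have "\<dots> = a * real (size M) + b * (\<Sum>x\<in>#M. x^2) + c * (\<Sum>x\<in>#M. \<bar>x\<bar>^3)"
    by (simp add: sum_mset.distrib sum_mset_distrib_left image_mset.compositionality comp_def)
  also have "\<dots> < a * (N + 1) + b * (N * (N + 1)) + c * (N^3 + N)"
    using mult_strict_left_mono[OF cubic c] by (simp only: size sq)
  also have "\<dots> = N * (a + b + c) + (a + b * N^2 + c * N^3)"
    by (simp add: algebra_simps power2_eq_square)
  also have "\<dots> = N powr p + N" using one top by simp
  finally show ?thesis .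
qed

text \<open>
  Both sides and their derivatives agree at \<open>x = -1\<close>, the value of all but one of the eigenvalues in
  the extremal configuration. A smaller \<open>s\<close> gives a better coefficient of the quadratic error term.
\<close>
lemma abs_cube_le_quadratic:
  fixes x s :: real
  assumes "\<bar>x\<bar> \<le> s"
  shows "\<bar>x\<bar>^3 \<le> 1 - 3 * (x + 1) + (2 + s) * (x + 1)^2"
proof -
  have "(2 + \<bar>x\<bar>) * (x + 1)^2 \<le> (2 + s) * (x + 1)^2"
    using assms by (intro mult_right_mono) auto
  moreover have "\<bar>x\<bar>^3 \<le> 1 - 3 * (x + 1) + (2 + \<bar>x\<bar>) * (x + 1)^2"
  proof (cases "x \<ge> 0")
    case True
    then show ?thesis by (simp add: power2_eq_square power3_eq_cube algebra_simps)
  next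
    case False
    then show ?thesis by (simp add: power2_eq_square power3_eq_cube algebra_simps)
  qed
  ultimately show ?thesis by simp
qed

text \<open>
  If \<open>\<rho> < N - 1\<close>, then \<open>\<bar>x\<bar>\<^sup>3 \<le> \<rho> x\<^sup>2\<close> is enough. Otherwise \<open>\<rho>\<close> uses up so much of the second
  moment that the other elements have modulus at most \<open>s = N - 5/4\<close>, and the quadratic bound
  can be summed: \<open>\<Sum>(x + 1)\<close> and \<open>\<Sum>(x + 1)\<^sup>2\<close> over the others are \<open>N - \<rho>\<close> and
  \<open>(N - \<rho>) (N + \<rho> + 2)\<close>. The factor \<open>N - \<rho>\<close> is thus common to the gain and the loss.
\<close>
lemma abs_cube_sum_less_nonneg_max:
  fixes M :: "real multiset" and N \<rho> :: real
  assumes N: "N \<ge> 5" and size: "real (size M) = N + 1"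
    and tr: "(\<Sum>x\<in>#M. x) = 0" and sq: "(\<Sum>x\<in>#M. x^2) = N * (N + 1)"
    and \<rho>: "\<rho> \<in># M" "\<rho> < N" and le: "\<And>x. x \<in># M \<Longrightarrow> \<bar>x\<bar> \<le> \<rho>"
  shows "(\<Sum>x\<in>#M. \<bar>x\<bar>^3) < N^3 + N"
proof (cases "\<rho> < N - 1")
  case True
  have "(\<Sum>x\<in>#M. \<bar>x\<bar>^3) \<le> (\<Sum>x\<in>#M. \<rho> * x^2)"
  proof (intro sum_mset_mono)
    fix x assume "x \<in># M"
    from mult_right_mono[OF le[OF this], of "x^2"] show "\<bar>x\<bar>^3 \<le> \<rho> * x^2"
      by (simp add: power3_eq_cube power2_eq_square abs_mult_self_eq mult.assoc)
  qed
  also have "\<dots> = \<rho> * (N * (N + 1))" by (simp add: sum_mset_distrib_left image_mset.compositionality comp_def flip: sq)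
  also have "\<dots> \<le> (N - 1) * (N * (N + 1))" using True N by (intro mult_right_mono) auto
  also have "\<dots> < N^3 + N" using N by (simp add: power3_eq_cube algebra_simps)
  finally show ?thesis .
next
  case False
  then have \<rho>1: "\<rho> \<ge> N - 1" by simp
  obtain M' where M: "M = add_mset \<rho> M'" using \<rho> by (metis insert_DiffM)
  have size': "real (size M') = N" using size by (simp add: M)
  have tr': "(\<Sum>x\<in>#M'. x) = - \<rho>" using tr by (simp add: M)
  have sq': "(\<Sum>x\<in>#M'. x^2) = N * (N + 1) - \<rho>^2" using sq by (simp add: M)
  \<comment> \<open>For \<open>N \<ge> 5\<close> the value \<open>N - 5/4\<close> is large enough for \<open>3 * N - 1 \<le> s\<^sup>2\<close> and still small
    enough for the final comparison; at \<open>N = 5\<close> there is little room on either side.\<close>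
  define s where "s = N - 5/4"
  have \<rho>sq: "\<rho>^2 \<ge> (N - 1)^2" using \<rho>1 N by (intro power_mono) auto
  have s: "\<bar>x\<bar> \<le> s" if x: "x \<in># M'" for x
  proof -
    obtain M'' where M'': "M' = add_mset x M''" using x by (metis insert_DiffM)
    have "0 \<le> (\<Sum>x\<in>#M''. x^2)" by (induction M'') auto
    then have "x^2 \<le> N * (N + 1) - \<rho>^2" using sq' by (simp add: M'')
    also have "\<dots> \<le> s^2"
    proof -
      have "0 \<le> (N - 5) * (N - 1/2)" using N by simp
      then show ?thesis using \<rho>sq N by (simp add: s_def power2_eq_square algebra_simps)
    qed
    finally show ?thesis using N by (simp add: s_def power2_le_iff_abs_le)
  qed
  have "(\<Sum>x\<in>#M'. \<bar>x\<bar>^3) \<le> (\<Sum>x\<in>#M'. 1 - 3 * (x + 1) + (2 + s) * (x + 1)^2)"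
    using s by (intro sum_mset_mono abs_cube_le_quadratic) auto
  also have "\<dots> = (\<Sum>x\<in>#M'. s + (2 * s + 1) * x + (2 + s) * x^2)"
    by (intro arg_cong[of _ _ sum_mset] image_mset_cong) (simp add: power2_eq_square algebra_simps)
  also have "\<dots> = s * real (size M') + (2 * s + 1) * (\<Sum>x\<in>#M'. x) + (2 + s) * (\<Sum>x\<in>#M'. x^2)"
    by (induction M') (auto simp: algebra_simps)
  also have "\<dots> = s * N + (2 * s + 1) * (- \<rho>) + (2 + s) * (N * (N + 1) - \<rho>^2)"
    by (simp only: tr' sq' size')
  finally have 1: "(\<Sum>x\<in>#M'. \<bar>x\<bar>^3) \<le> s * N + (2 * s + 1) * (- \<rho>) + (2 + s) * (N * (N + 1) - \<rho>^2)" .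
  have "0 < (N - \<rho>) * (N^2 + N * \<rho> + \<rho>^2 + 3 - (2 + s) * (N + \<rho> + 2))"
  proof (intro mult_pos_pos)
    have "0 \<le> (N - 5) * (N - 1/2)" using N by simp
    moreover have "0 \<le> (\<rho> - (N - 1)) * (\<rho> + (N - 1) - 3/4)" using \<rho>1 N by (intro mult_nonneg_nonneg) auto
    ultimately show "0 < N^2 + N * \<rho> + \<rho>^2 + 3 - (2 + s) * (N + \<rho> + 2)"
      using N by (simp add: s_def power2_eq_square field_simps)
  qed (use \<rho> in simp)
  then have "\<rho>^3 + (s * N + (2 * s + 1) * (- \<rho>) + (2 + s) * (N * (N + 1) - \<rho>^2)) < N^3 + N"
    by (simp add: power2_eq_square power3_eq_cube algebra_simps)
  moreover have "\<bar>\<rho>\<bar>^3 = \<rho>^3" using \<rho>1 N by simp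
  ultimately show ?thesis using 1 by (simp add: M)
qed

text \<open>
  The hypotheses are invariant under \<open>x \<mapsto> -x\<close>, so the element of largest modulus may be taken to be
  nonnegative.
\<close>
lemma abs_cube_sum_less:
  fixes M :: "real multiset" and N :: real
  assumes N: "N \<ge> 5" and size: "real (size M) = N + 1"
    and tr: "(\<Sum>x\<in>#M. x) = 0" and sq: "(\<Sum>x\<in>#M. x^2) = N * (N + 1)"
    and less: "\<And>x. x \<in># M \<Longrightarrow> \<bar>x\<bar> < N"
  shows "(\<Sum>x\<in>#M. \<bar>x\<bar>^3) < N^3 + N"
proof -
  have ne: "set_mset M \<noteq> {}" using size N by auto
  then have "Max (abs ` set_mset M) \<in> abs ` set_mset M" by (intro Max_in) auto
  then obtain y where y: "y \<in># M" "\<bar>y\<bar> = Max (abs ` set_mset M)" by auto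
  have ymax: "\<bar>x\<bar> \<le> \<bar>y\<bar>" if "x \<in># M" for x using that y(2) by simp
  show ?thesis
  proof (cases "y \<ge> 0")
    case True
    with abs_cube_sum_less_nonneg_max[OF N size tr sq y(1)] less[OF y(1)] ymax show ?thesis by simp
  next
    case False
    have "(\<Sum>x\<in>#image_mset uminus M. \<bar>x\<bar>^3) < N^3 + N"
    proof (rule abs_cube_sum_less_nonneg_max[OF N])
      show "- y \<in># image_mset uminus M" using y by simp
      have "(\<Sum>x\<in>#M. - x) = - (\<Sum>x\<in>#M. x)" by (induction M) auto
      then show "(\<Sum>x\<in>#image_mset uminus M. x) = 0" using tr by simp
    qed (use assms less[OF y(1)] ymax False in \<open>auto simp: image_mset.compositionality comp_def\<close>)
    then show ?thesis by (simp add: image_mset.compositionality comp_def)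
  qed
qed

text \<open>
  The moments leave \<open>\<Sum>(x + 1)\<^sup>2 = 0\<close> for the elements other than \<open>N\<close>.
\<close>
lemma power_sum_rank_one_spectrum:
  fixes M :: "real multiset" and N p :: real
  assumes size: "real (size M) = N + 1" and N: "N \<ge> 0"
    and tr: "(\<Sum>x\<in>#M. x) = 0" and sq: "(\<Sum>x\<in>#M. x^2) = N * (N + 1)"
    and "N \<in># M"
  shows "(\<Sum>x\<in>#M. \<bar>x\<bar> powr p) = N powr p + N"
proof -
  obtain M' where M: "M = add_mset N M'" using \<open>N \<in># M\<close> by (metis insert_DiffM)
  have size': "real (size M') = N" using size by (simp add: M)
  have tr': "(\<Sum>x\<in>#M'. x) = - N" using tr by (simp add: M)
  have sq': "(\<Sum>x\<in>#M'. x^2) = N * (N + 1) - N^2" using sq by (simp add: M)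
  have "(\<Sum>x\<in>#M'. (x + 1)^2) = (\<Sum>x\<in>#M'. x^2) + 2 * (\<Sum>x\<in>#M'. x) + real (size M')"
    by (induction M') (auto simp: power2_eq_square algebra_simps)
  also have "\<dots> = 0" by (simp only: size' tr' sq') (simp add: power2_eq_square algebra_simps)
  finally have 0: "(\<Sum>x\<in>#M'. (x + 1)^2) = 0" .
  have "x = -1" if x: "x \<in># M'" for x
  proof -
    obtain M'' where "M' = add_mset x M''" using x by (metis insert_DiffM)
    moreover have "0 \<le> (\<Sum>x\<in>#M''. (x + 1)^2)" by (induction M'') auto
    ultimately have "(x + 1)^2 \<le> 0" using 0 by (simp only: image_mset_add_mset sum_mset.add_mset)
    then show ?thesis by simp
  qed
  then have "(\<Sum>x\<in>#M'. \<bar>x\<bar> powr p) = (\<Sum>x\<in>#M'. 1)"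
    by (intro arg_cong[of _ _ sum_mset] image_mset_cong) force
  then show ?thesis using N by (simp add: M size')
qed

section \<open>Spectra of real symmetric matrices\<close>

text \<open>
  For an eigenvector \<open>v\<close> the number \<open>q = v\<^sup>* A v\<close> is real because \<open>A\<close> is real symmetric, and it
  equals \<open>a\<close> times the positive number \<open>v\<^sup>* v\<close>.
\<close>
lemma symmetric_real_mat_eigenvalue_real:
  fixes A :: "real mat"
  assumes A: "A \<in> carrier_mat n n"
    and sym: "\<And>i j. i < n \<Longrightarrow> j < n \<Longrightarrow> A $$ (i,j) = A $$ (j,i)"
    and ev: "eigenvalue (map_mat complex_of_real A) a"
  shows "a \<in> \<real>"
proof -
  let ?C = "map_mat complex_of_real A"
  obtain v where v: "v \<in> carrier_vec n" "v \<noteq> 0\<^sub>v n" "?C *\<^sub>v v = a \<cdot>\<^sub>v v"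
    using ev A unfolding eigenvalue_def eigenvector_def by auto
  have row: "(\<Sum>j<n. of_real (A $$ (i,j)) * v $ j) = a * v $ i" if "i < n" for i
  proof -
    have "(?C *\<^sub>v v) $ i = (\<Sum>j<n. of_real (A $$ (i,j)) * v $ j)"
      using that A v(1) by (simp add: scalar_prod_def lessThan_atLeast0)
    then show ?thesis using that v by simp
  qed
  define q where "q = (\<Sum>i<n. \<Sum>j<n. cnj (v $ i) * (of_real (A $$ (i,j)) * v $ j))"
  define w where "w = (\<Sum>i<n. (cmod (v $ i))^2)"
  have "q = (\<Sum>i<n. cnj (v $ i) * (a * v $ i))"
    unfolding q_def sum_distrib_left[symmetric] using row by (intro sum.cong) auto
  also have "\<dots> = a * of_real w"
    by (simp add: w_def sum_distrib_left complex_norm_square[unfolded of_real_power] mult_ac)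
  finally have q: "q = a * of_real w" .
  have "cnj q = (\<Sum>i<n. \<Sum>j<n. cnj (v $ j) * (of_real (A $$ (j,i)) * v $ i))"
    unfolding q_def cnj_sum using sym by (intro sum.cong) (auto simp: mult_ac)
  also have "\<dots> = q" unfolding q_def by (rule sum.swap)
  finally have "q \<in> \<real>" by (simp add: Reals_cnj_iff)
  moreover have "w > 0"
  proof -
    obtain i where "i < n" "v $ i \<noteq> 0" using v(1,2) by (metis eq_vecI carrier_vecD index_zero_vec)
    then show ?thesis unfolding w_def by (intro sum_pos2[of _ i]) auto
  qed
  ultimately show ?thesis
    using q by (metis Reals_divide Reals_of_real nonzero_mult_div_cancel_right of_real_eq_0_iff less_irrefl)
qed

text \<open>
  The characteristic polynomial splits over the complex numbers, and its roots there are real.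
\<close>
lemma symmetric_real_char_poly_splits:
  fixes A :: "real mat"
  assumes A: "A \<in> carrier_mat n n"
    and sym: "\<And>i j. i < n \<Longrightarrow> j < n \<Longrightarrow> A $$ (i,j) = A $$ (j,i)"
  obtains es where "char_poly A = (\<Prod>e\<leftarrow>es. [:- e, 1:])" "length es = n"
proof -
  let ?C = "map_mat complex_of_real A"
  interpret h: map_poly_inj_idom_hom complex_of_real ..
  have C: "?C \<in> carrier_mat n n" using A by simp
  obtain as where as: "char_poly ?C = (\<Prod>a\<leftarrow>as. [:- a, 1:])" "length as = n"
    using char_poly_factorized[OF C] by auto
  have "a \<in> \<real>" if "a \<in> set as" for a
  proof (rule symmetric_real_mat_eigenvalue_real[OF A sym])
    show "eigenvalue ?C a"
      unfolding eigenvalue_root_char_poly[OF C] as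
      using that by (induction as) auto
  qed auto
  then have "as = map (complex_of_real \<circ> Re) as" by (intro map_idI[symmetric]) auto
  then have "map_poly complex_of_real (char_poly A)
      = (\<Prod>a\<leftarrow>map (complex_of_real \<circ> Re) as. [:- a, 1:])"
    using as(1) of_real_hom.char_poly_hom[OF A] by metis
  also have "\<dots> = map_poly complex_of_real (\<Prod>e\<leftarrow>map Re as. [:- e, 1:])"
    by (simp add: h.hom_prod_list comp_def)
  finally have "char_poly A = (\<Prod>e\<leftarrow>map Re as. [:- e, 1:])"
    by (rule h.injectivity)
  then show thesis by (rule that) (use as(2) in simp)
qed

lemma trace_mult_commute:
  fixes A B :: "'a :: comm_semiring_0 mat"
  assumes "A \<in> carrier_mat n n" "B \<in> carrier_mat n n"
  shows "(\<Sum>i<n. (A * B) $$ (i,i)) = (\<Sum>i<n. (B * A) $$ (i,i))"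
proof -
  have "(\<Sum>i<n. (A * B) $$ (i,i)) = (\<Sum>i<n. \<Sum>j<n. A $$ (i,j) * B $$ (j,i))"
    using assms by (simp add: scalar_prod_def lessThan_atLeast0)
  also have "\<dots> = (\<Sum>i<n. \<Sum>j<n. A $$ (j,i) * B $$ (i,j))" by (rule sum.swap)
  also have "\<dots> = (\<Sum>i<n. (B * A) $$ (i,i))"
    using assms by (simp add: scalar_prod_def lessThan_atLeast0 mult.commute)
  finally show ?thesis .
qed

lemma trace_conjugate:
  fixes B P Q :: "'a :: comm_ring_1 mat"
  assumes "B \<in> carrier_mat n n" "P \<in> carrier_mat n n" "Q \<in> carrier_mat n n" "Q * P = 1\<^sub>m n"
  shows "(\<Sum>i<n. (P * B * Q) $$ (i,i)) = (\<Sum>i<n. B $$ (i,i))"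
proof -
  have "(\<Sum>i<n. (P * B * Q) $$ (i,i)) = (\<Sum>i<n. (Q * (P * B)) $$ (i,i))"
    using assms by (intro trace_mult_commute) auto
  also have "Q * (P * B) = B"
    using assms assoc_mult_mat[of Q n n P n B n] by simp
  finally show ?thesis .
qed

text \<open>
  Schur triangularisation \<open>A = P B Q\<close> puts the eigenvalues on the diagonal of the triangular matrix
  \<open>B\<close>; their squares are then the diagonal of \<open>B\<^sup>2\<close>, and \<open>A\<^sup>2 = P B\<^sup>2 Q\<close>. Traces are invariant under
  this conjugation.
\<close>
lemma sum_eigenvalues:
  fixes A :: "'a :: conjugatable_ordered_field mat"
  assumes A: "A \<in> carrier_mat n n" and c: "char_poly A = (\<Prod>e\<leftarrow>es. [:- e, 1:])"
  shows "(\<Sum>e\<leftarrow>es. e) = (\<Sum>i<n. A $$ (i,i))"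
    and "(\<Sum>e\<leftarrow>es. e^2) = (\<Sum>i<n. \<Sum>j<n. A $$ (i,j) * A $$ (j,i))"
proof -
  obtain B P Q where BPQ: "schur_decomposition A es = (B,P,Q)" by (metis prod_cases3)
  from schur_decomposition[OF A c BPQ]
  have sim: "similar_mat_wit A B P Q" and ut: "upper_triangular B" and diag: "diag_mat B = es" by auto
  note PQ = similar_mat_witD2[OF A sim]
  have es: "(\<Sum>e\<leftarrow>es. f e) = (\<Sum>i<n. f (B $$ (i,i)))" for f :: "'a \<Rightarrow> 'a"
    unfolding diag[symmetric] diag_mat_def using PQ(5)
    by (simp add: comp_def interv_sum_list_conv_sum_set_nat lessThan_atLeast0)
  show "(\<Sum>e\<leftarrow>es. e) = (\<Sum>i<n. A $$ (i,i))"
    unfolding es PQ(3) using PQ by (intro trace_conjugate[symmetric]) auto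
  have BB: "(B * B) $$ (i,i) = (B $$ (i,i))^2" if i: "i < n" for i
  proof -
    have "(B * B) $$ (i,i) = (\<Sum>j<n. B $$ (i,j) * B $$ (j,i))"
      using i PQ(5) by (simp add: scalar_prod_def lessThan_atLeast0)
    also have "\<dots> = (\<Sum>j\<in>{i}. B $$ (i,j) * B $$ (j,i))"
    proof (rule sum.mono_neutral_right)
      show "\<forall>j\<in>{..<n} - {i}. B $$ (i,j) * B $$ (j,i) = 0"
      proof
        fix j assume j: "j \<in> {..<n} - {i}"
        then consider "j < i" | "i < j" by fastforce
        then show "B $$ (i,j) * B $$ (j,i) = 0"
          using upper_triangularD[OF ut, of j i] upper_triangularD[OF ut, of i j] PQ(5) i j by cases auto
      qed
    qed (use i in auto)
    finally show ?thesis by (simp add: power2_eq_square)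
  qed
  have AA: "A * A = P * (B * B) * Q"
  proof -
    have "A * A = P * B * (Q * P) * B * Q"
      unfolding PQ(3) using PQ(5,6,7) by (simp add: assoc_mult_mat[of _ n n _ n _ n])
    then show ?thesis using PQ by (simp add: assoc_mult_mat[of _ n n _ n _ n])
  qed
  have "(\<Sum>e\<leftarrow>es. e^2) = (\<Sum>i<n. (B * B) $$ (i,i))"
    unfolding es by (simp add: BB)
  also have "\<dots> = (\<Sum>i<n. (A * A) $$ (i,i))"
    unfolding AA using PQ by (intro trace_conjugate[symmetric]) auto
  also have "\<dots> = (\<Sum>i<n. \<Sum>j<n. A $$ (i,j) * A $$ (j,i))"
    using A by (simp add: scalar_prod_def lessThan_atLeast0)
  finally show "(\<Sum>e\<leftarrow>es. e^2) = (\<Sum>i<n. \<Sum>j<n. A $$ (i,j) * A $$ (j,i))" .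
qed

lemma proots_prod_linear: "proots (\<Prod>e\<leftarrow>es. [:- e, 1:]) = mset (es :: 'a :: idom list)"
proof (induction es)
  case (Cons e es)
  have "proots ([:- e, 1:] * (\<Prod>e\<leftarrow>es. [:- e, 1:])) = proots [:- e, 1:] + proots (\<Prod>e\<leftarrow>es. [:- e, 1:])"
  proof (rule proots_mult)
    show "[:- e, 1:] \<noteq> 0" by simp
    show "(\<Prod>e\<leftarrow>es. [:- e, 1:]) \<noteq> 0" unfolding prod_list_zero_iff by auto
  qed
  also have "\<dots> = mset (e # es)" using Cons by simp
  finally show ?case by (simp only: list.map prod_list.Cons)
qed simp

lemma symmetric_real_mat_spectrum:
  fixes A :: "real mat"
  assumes A: "A \<in> carrier_mat n n"
    and sym: "\<And>i j. i < n \<Longrightarrow> j < n \<Longrightarrow> A $$ (i,j) = A $$ (j,i)"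
  defines "M \<equiv> proots (char_poly A)"
  shows "size M = n"
    and "(\<Sum>x\<in>#M. x) = (\<Sum>i<n. A $$ (i,i))"
    and "(\<Sum>x\<in>#M. x^2) = (\<Sum>i<n. \<Sum>j<n. (A $$ (i,j))^2)"
    and "x \<in># M \<longleftrightarrow> eigenvalue A x"
proof -
  obtain es where es: "char_poly A = (\<Prod>e\<leftarrow>es. [:- e, 1:])" "length es = n"
    using symmetric_real_char_poly_splits[OF A sym] by blast
  have M: "M = mset es" by (simp add: M_def es(1) proots_prod_linear)
  show "size M = n" using M es(2) by simp
  show "(\<Sum>x\<in>#M. x) = (\<Sum>i<n. A $$ (i,i))"
    using sum_eigenvalues(1)[OF A es(1)] by (simp add: M sum_mset_sum_list)
  show "(\<Sum>x\<in>#M. x^2) = (\<Sum>i<n. \<Sum>j<n. (A $$ (i,j))^2)"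
    using sum_eigenvalues(2)[OF A es(1)] sym
    by (simp add: M power2_eq_square flip: sum_mset_sum_list mset_map)
  show "x \<in># M \<longleftrightarrow> eigenvalue A x"
    unfolding M_def eigenvalue_root_char_poly[OF A] using degree_monic_char_poly[OF A]
    by (subst set_count_proots) auto
qed

section \<open>Symmetric sign matrices with zero diagonal\<close>

context
  fixes S :: "real mat" and n :: nat
  assumes S: "S \<in> carrier_mat n n"
    and diag: "\<And>i. i < n \<Longrightarrow> S $$ (i,i) = 0"
    and off_diag: "\<And>i j. i < n \<Longrightarrow> j < n \<Longrightarrow> i \<noteq> j \<Longrightarrow> \<bar>S $$ (i,j)\<bar> = 1"
begin

lemma mult_vec_off_diag:
  assumes "v \<in> carrier_vec n" "i < n"
  shows "(S *\<^sub>v v) $ i = (\<Sum>j\<in>{..<n} - {i}. S $$ (i,j) * v $ j)"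
proof -
  have "(S *\<^sub>v v) $ i = (\<Sum>j<n. S $$ (i,j) * v $ j)"
    using assms S by (simp add: scalar_prod_def lessThan_atLeast0)
  also have "\<dots> = (\<Sum>j\<in>{..<n} - {i}. S $$ (i,j) * v $ j)"
    using assms diag by (subst sum.remove[of _ i]) auto
  finally show ?thesis .
qed

lemma sum_entries_sq: "(\<Sum>i<n. \<Sum>j<n. (S $$ (i,j))^2) = (real n - 1) * real n"
proof -
  have "(\<Sum>j<n. (S $$ (i,j))^2) = real n - 1" if i: "i < n" for i
  proof -
    have "(\<Sum>j<n. (S $$ (i,j))^2) = (\<Sum>j\<in>{..<n} - {i}. (S $$ (i,j))^2)"
      using i diag by (subst sum.remove[of _ i]) auto
    also have "\<dots> = (\<Sum>j\<in>{..<n} - {i}. 1)"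
      using i off_diag by (intro sum.cong) (auto simp: abs_square_eq_1)
    finally show ?thesis using i by simp
  qed
  then show ?thesis by simp
qed

text \<open>
  Gershgorin's estimate, kept in the form before the other entries are bounded by the largest
  one, since the equality case needs the individual entries.
\<close>
lemma eigenvector_max_entry:
  assumes "eigenvector S v x"
  obtains k where "k < n" "\<forall>j<n. \<bar>v $ j\<bar> \<le> \<bar>v $ k\<bar>" "\<bar>v $ k\<bar> > 0"
    "\<bar>x\<bar> * \<bar>v $ k\<bar> \<le> (\<Sum>j\<in>{..<n} - {k}. \<bar>v $ j\<bar>)"
proof -
  have v: "v \<in> carrier_vec n" "v \<noteq> 0\<^sub>v n" "S *\<^sub>v v = x \<cdot>\<^sub>v v"
    using assms S unfolding eigenvector_def by auto
  obtain i where i: "i < n" "v $ i \<noteq> 0" using v(1,2) by (metis eq_vecI carrier_vecD index_zero_vec)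
  have "Max ((\<lambda>j. \<bar>v $ j\<bar>) ` {..<n}) \<in> (\<lambda>j. \<bar>v $ j\<bar>) ` {..<n}"
    using i by (intro Max_in) auto
  then obtain k where k: "k < n" "\<bar>v $ k\<bar> = Max ((\<lambda>j. \<bar>v $ j\<bar>) ` {..<n})" by auto
  have max: "\<bar>v $ j\<bar> \<le> \<bar>v $ k\<bar>" if "j < n" for j using that k(2) by simp
  have "\<bar>x\<bar> * \<bar>v $ k\<bar> = \<bar>(S *\<^sub>v v) $ k\<bar>" using v k by (simp add: abs_mult)
  also have "\<dots> \<le> (\<Sum>j\<in>{..<n} - {k}. \<bar>S $$ (k,j) * v $ j\<bar>)"
    unfolding mult_vec_off_diag[OF v(1) k(1)] by (rule sum_abs)
  also have "\<dots> = (\<Sum>j\<in>{..<n} - {k}. \<bar>v $ j\<bar>)"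
    using off_diag k by (intro sum.cong) (auto simp: abs_mult)
  finally show thesis using that k(1) max max[OF i(1)] i(2) by force
qed

lemma abs_eigenvalue_le:
  assumes "eigenvalue S x"
  shows "\<bar>x\<bar> \<le> real n - 1"
proof -
  obtain v where "eigenvector S v x" using assms by (auto simp: eigenvalue_def)
  then obtain k where k: "k < n" "\<forall>j<n. \<bar>v $ j\<bar> \<le> \<bar>v $ k\<bar>" "\<bar>v $ k\<bar> > 0"
    "\<bar>x\<bar> * \<bar>v $ k\<bar> \<le> (\<Sum>j\<in>{..<n} - {k}. \<bar>v $ j\<bar>)"
    by (rule eigenvector_max_entry)
  note k(4)
  also have "(\<Sum>j\<in>{..<n} - {k}. \<bar>v $ j\<bar>) \<le> (\<Sum>j\<in>{..<n} - {k}. \<bar>v $ k\<bar>)"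
    using k(2) by (intro sum_mono) auto
  also have "\<dots> = (real n - 1) * \<bar>v $ k\<bar>" using k(1) by simp
  finally show ?thesis using k(3) by simp
qed

text \<open>
  Equality in Gershgorin's estimate makes all entries of the eigenvector equal in modulus. Each row of
  the eigenvector equation then says that \<open>n - 1\<close> signs add up to \<open>\<plusminus>(n - 1)\<close>, so they all agree. Here
  \<open>s\<close> is the sign vector of the eigenvector and \<open>\<epsilon>\<close> the sign of the eigenvalue.
\<close>
lemma extremal_eigenvalue_rank_one:
  assumes "eigenvalue S x" "\<bar>x\<bar> = real n - 1"
  obtains \<epsilon> :: real and s :: "nat \<Rightarrow> real" where "\<bar>\<epsilon>\<bar> = 1" "\<forall>i<n. \<bar>s i\<bar> = 1"
    "\<forall>i<n. \<forall>j<n. i \<noteq> j \<longrightarrow> S $$ (i,j) = \<epsilon> * s i * s j"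
proof -
  obtain v where ev: "eigenvector S v x" using assms by (auto simp: eigenvalue_def)
  then have v: "v \<in> carrier_vec n" "S *\<^sub>v v = x \<cdot>\<^sub>v v"
    using S unfolding eigenvector_def by auto
  from ev obtain k where k: "k < n" "\<forall>j<n. \<bar>v $ j\<bar> \<le> \<bar>v $ k\<bar>" "\<bar>v $ k\<bar> > 0"
    "\<bar>x\<bar> * \<bar>v $ k\<bar> \<le> (\<Sum>j\<in>{..<n} - {k}. \<bar>v $ j\<bar>)"
    by (rule eigenvector_max_entry)
  define m where "m = \<bar>v $ k\<bar>"
  have m: "m > 0" using k(3) by (simp add: m_def)
  have "(\<Sum>j\<in>{..<n} - {k}. m - \<bar>v $ j\<bar>) \<le> 0"
    using k(1,4) assms(2) by (simp add: sum_subtractf m_def)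
  moreover have nonneg: "0 \<le> m - \<bar>v $ j\<bar>" if "j \<in> {..<n} - {k}" for j
    using k(2) that by (simp add: m_def)
  moreover have "0 \<le> (\<Sum>j\<in>{..<n} - {k}. m - \<bar>v $ j\<bar>)"
    using nonneg by (rule sum_nonneg)
  ultimately have "\<forall>j\<in>{..<n} - {k}. m - \<bar>v $ j\<bar> = 0"
    by (subst sum_nonneg_eq_0_iff[symmetric]) (auto intro: antisym)
  then have const: "\<bar>v $ j\<bar> = m" if "j < n" for j using that by (cases "j = k") (auto simp: m_def)
  define s where "s i = v $ i / m" for i
  define \<epsilon> where "\<epsilon> = (if x \<ge> 0 then 1 else -1 :: real)"
  have \<epsilon>: "\<bar>\<epsilon>\<bar> = 1" "\<epsilon> * x = real n - 1" using assms(2) by (auto simp: \<epsilon>_def)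
  have s: "\<bar>s i\<bar> = 1" if "i < n" for i using const[OF that] m by (simp add: s_def)
  have s2: "s i * s i = 1" if "i < n" for i using s[OF that] by (metis abs_mult_self_eq mult_1)
  have "S $$ (i,j) = \<epsilon> * s i * s j" if ij: "i < n" "j < n" "i \<noteq> j" for i j
  proof -
    have le: "\<epsilon> * s i * (S $$ (i,l) * s l) \<le> 1" if "l < n" "l \<noteq> i" for l
    proof -
      have "\<bar>\<epsilon> * s i * (S $$ (i,l) * s l)\<bar> = 1"
        using that \<epsilon> s ij off_diag[of i l] by (simp add: abs_mult)
      then show ?thesis by linarith
    qed
    have "(\<Sum>l\<in>{..<n} - {i}. S $$ (i,l) * s l) = (S *\<^sub>v v) $ i / m"
      unfolding mult_vec_off_diag[OF v(1) ij(1)] s_def by (simp add: sum_divide_distrib)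
    also have "\<dots> = x * s i" using v ij by (simp add: s_def)
    finally have "(\<Sum>l\<in>{..<n} - {i}. \<epsilon> * s i * (S $$ (i,l) * s l)) = \<epsilon> * s i * (x * s i)"
      by (simp add: sum_distrib_left[symmetric])
    also have "\<dots> = (\<epsilon> * x) * (s i * s i)" by (simp only: mult_ac)
    also have "\<dots> = real n - 1" using s2[OF ij(1)] \<epsilon>(2) by simp
    finally have "(\<Sum>l\<in>{..<n} - {i}. 1 - \<epsilon> * s i * (S $$ (i,l) * s l)) = 0"
      using ij by (simp add: sum_subtractf)
    then have "\<forall>l\<in>{..<n} - {i}. 1 - \<epsilon> * s i * (S $$ (i,l) * s l) = 0"
      using le by (subst (asm) sum_nonneg_eq_0_iff) auto
    then have *: "\<epsilon> * s i * (S $$ (i,j) * s j) = 1" using ij by auto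
    \<comment> \<open>Signs are their own inverses, so this determines the entry.\<close>
    have "\<epsilon> * \<epsilon> = 1" using \<epsilon>(1) by (metis abs_mult_self_eq mult_1)
    then have "S $$ (i,j) = (\<epsilon> * \<epsilon>) * (s i * s i) * (s j * s j) * S $$ (i,j)"
      using s2 ij by simp
    also have "\<dots> = \<epsilon> * s i * s j * (\<epsilon> * s i * (S $$ (i,j) * s j))" by (simp only: mult_ac)
    finally show ?thesis using * by simp
  qed
  then show thesis using that \<epsilon>(1) s by blast
qed

lemma rank_one_eigenvalue:
  assumes "n > 0" and s: "\<And>i. i < n \<Longrightarrow> \<bar>s i\<bar> = (1 :: real)"
    and Ss: "\<And>i j. i < n \<Longrightarrow> j < n \<Longrightarrow> i \<noteq> j \<Longrightarrow> S $$ (i,j) = s i * s j"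
  shows "eigenvalue S (real n - 1)"
proof -
  let ?v = "vec n s"
  have "S *\<^sub>v ?v = (real n - 1) \<cdot>\<^sub>v ?v"
  proof (rule eq_vecI)
    fix i assume "i < dim_vec ((real n - 1) \<cdot>\<^sub>v ?v)"
    then have i: "i < n" by simp
    have "(S *\<^sub>v ?v) $ i = (\<Sum>j\<in>{..<n} - {i}. S $$ (i,j) * ?v $ j)"
      using i by (intro mult_vec_off_diag) auto
    also have "\<dots> = (\<Sum>j\<in>{..<n} - {i}. s i)"
    proof (intro sum.cong refl)
      fix j assume j: "j \<in> {..<n} - {i}"
      then have "s j * s j = 1" using s by (metis DiffD1 abs_mult_self_eq lessThan_iff mult_1)
      then show "S $$ (i,j) * ?v $ j = s i" using i j Ss by (auto simp: mult.assoc)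
    qed
    finally show "(S *\<^sub>v ?v) $ i = ((real n - 1) \<cdot>\<^sub>v ?v) $ i" using i by simp
  qed (use S in auto)
  moreover have "?v \<noteq> 0\<^sub>v n"
    using s[of 0] \<open>n > 0\<close> by (metis abs_zero index_vec index_zero_vec(1) zero_neq_one)
  ultimately show ?thesis using S unfolding eigenvalue_def eigenvector_def
    by (intro exI[of _ ?v]) auto
qed

end

section \<open>Regular graphs with twice as many vertices as their degree\<close>

lemma out_degree_eq_card_neighbours:
  assumes "graph G"
  shows "out_degree G v = card {w. (v, w) \<in> arcs_ends G}"
proof -
  interpret graph G by fact
  have "{w. (v, w) \<in> arcs_ends G} = head G ` out_arcs G v"
    by (auto simp: arcs_ends_conv out_arcs_def)
  moreover have "inj_on (head G) (out_arcs G v)"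
    by (auto simp: inj_on_def arc_to_ends_def intro: no_multi_arcs)
  ultimately show ?thesis by (simp add: out_degree_def card_image)
qed

context
  fixes G :: "('a, 'b) pre_digraph" and r :: nat
  assumes reg: "regular_graph r G" and card: "card (verts G) = 2 * r"
begin

lemma regular_graph_neighbours:
  shows "graph G" and "v \<in> verts G \<Longrightarrow> card {w. (v, w) \<in> arcs_ends G} = r"
    and "(v, w) \<in> arcs_ends G \<Longrightarrow> v \<in> verts G \<and> w \<in> verts G \<and> v \<noteq> w \<and> (w, v) \<in> arcs_ends G"
    and "finite (verts G)"
proof -
  show G: "graph G" using reg by (simp add: regular_graph_def)
  then interpret graph G .
  show "v \<in> verts G \<Longrightarrow> card {w. (v, w) \<in> arcs_ends G} = r"
    using reg out_degree_eq_card_neighbours[OF G] by (auto simp: regular_graph_def)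
  show "(v, w) \<in> arcs_ends G \<Longrightarrow> v \<in> verts G \<and> w \<in> verts G \<and> v \<noteq> w \<and> (w, v) \<in> arcs_ends G"
    using adj_in_verts adj_not_same arcs_ends_symmetric[OF sym_arcs] by metis
  show "finite (verts G)" by simp
qed

text \<open>
  It suffices to know the neighbourhoods on one side. A vertex of \<open>A\<close> is then adjacent to all of
  \<open>B\<close>, which has \<open>r\<close> elements, and by its degree it has no other neighbours.
\<close>
lemma complete_bipartiteI_common_neighbours:
  assumes AB: "verts G = A \<union> B" "A \<inter> B = {}" and ne: "B \<noteq> {}"
    and nb: "\<And>u. u \<in> B \<Longrightarrow> {w. (u, w) \<in> arcs_ends G} = A"
  shows "complete_bipartite_digraph r r G"
proof -
  note G = regular_graph_neighbours
  have fin: "finite A" "finite B" using G(4) AB by auto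
  have A: "card A = r" using ne nb G(2) AB by (metis UnI2 ex_in_conv)
  then have B: "card B = r" using card AB fin by (simp add: card_Un_disjoint)
  have nbA: "{w. (a, w) \<in> arcs_ends G} = B" if a: "a \<in> A" for a
  proof (rule card_subset_eq[symmetric])
    show "B \<subseteq> {w. (a, w) \<in> arcs_ends G}" using a nb G(3) by blast
    show "card B = card {w. (a, w) \<in> arcs_ends G}" using a B G(2) AB by auto
    show "finite {w. (a, w) \<in> arcs_ends G}"
      using G(3) by (intro finite_subset[OF _ G(4)]) blast
  qed
  have "(u, w) \<in> arcs_ends G \<longleftrightarrow> (u, w) \<in> A \<times> B \<union> B \<times> A" for u w
    using nb nbA AB G(3)[of u w] by blast
  then have "arcs_ends G = A \<times> B \<union> B \<times> A" by auto
  with AB A B G(1) show ?thesis unfolding complete_bipartite_digraph_def by blast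
qed

text \<open>
  The set \<open>B\<close> of non-neighbours of a vertex \<open>v\<close> has \<open>r\<close> elements, including \<open>v\<close>. For \<open>r \<le> 2\<close> there is
  at most one other element, which is not adjacent to \<open>v\<close> and so has all of its neighbours outside
  \<open>B\<close>. These small graphs have to be treated by hand, as the inequality for the cubes is
  derived for \<open>n - 1 \<ge> 5\<close>.
\<close>
lemma complete_bipartite_if_small:
  assumes "1 \<le> r" "r \<le> 2"
  shows "complete_bipartite_digraph r r G"
proof -
  note G = regular_graph_neighbours
  obtain v where v: "v \<in> verts G" using card assms by (metis card.empty ex_in_conv mult_is_0 not_one_le_zero zero_neq_numeral)
  define A where "A = {w. (v, w) \<in> arcs_ends G}"
  define B where "B = verts G - A"
  have A: "A \<subseteq> verts G" "card A = r" "v \<in> B" using G(2,3) v by (auto simp: A_def B_def)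
  have B: "card B = r" using A card G(4) by (simp add: B_def card_Diff_subset finite_subset)
  have fin: "finite A" using A(1) G(4) finite_subset by blast
  have nb: "{w. (u, w) \<in> arcs_ends G} = A" if u: "u \<in> B" for u
  proof (cases "u = v")
    case False
    have "card {u, v} = 2" using False by simp
    moreover have "card {u, v} \<le> card B" 
      using u A(3) G(4) by (intro card_mono) (auto simp: B_def)
    ultimately have "B = {u, v}" using B assms u A(3) G(4)
      by (intro card_subset_eq[symmetric]) (auto simp: B_def)
    have "w \<in> A" if w: "(u, w) \<in> arcs_ends G" for w
    proof -
      have "(u, v) \<notin> arcs_ends G" using u G(3)[of u v] by (auto simp: A_def B_def)
      then have "w \<notin> B" using w G(3)[OF w] \<open>B = {u, v}\<close> by auto
      then show ?thesis using G(3)[OF w] by (auto simp: B_def)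
    qed
    then have "{w. (u, w) \<in> arcs_ends G} \<subseteq> A" by blast
    then show ?thesis using G(2) u A(2) fin by (intro card_subset_eq) (auto simp: B_def)
  qed (simp add: A_def)
  show ?thesis
    using A nb by (intro complete_bipartiteI_common_neighbours[of A B]) (auto simp: B_def)
qed

text \<open>
  If the adjacent pairs are those of different colours, the colour classes are the two sides. If they are
  those of equal colours, the class of a vertex \<open>v\<close> is a clique with \<open>r + 1\<close> elements, which leaves
  \<open>r - 1 \<ge> 1\<close> vertices for the other clique, too few for degree \<open>r\<close>.
\<close>
lemma complete_bipartite_if_two_coloured:
  assumes r: "r \<ge> 2"
    and adj: "(\<forall>u\<in>verts G. \<forall>w\<in>verts G. u \<noteq> w \<longrightarrow> ((u, w) \<in> arcs_ends G \<longleftrightarrow> c u \<noteq> c w)) \<or>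
       (\<forall>u\<in>verts G. \<forall>w\<in>verts G. u \<noteq> w \<longrightarrow> ((u, w) \<in> arcs_ends G \<longleftrightarrow> c u = c w))"
      (is "?bipartite \<or> ?cliques")
    and c: "\<And>u. u \<in> verts G \<Longrightarrow> c u \<in> {a, b}"
  shows "complete_bipartite_digraph r r G"
proof -
  note G = regular_graph_neighbours
  obtain v where v: "v \<in> verts G" using card r by (metis card.empty ex_in_conv mult_is_0 not_numeral_le_zero zero_neq_numeral)
  define B where "B = {u \<in> verts G. c u = c v}"
  define A where "A = {u \<in> verts G. c u \<noteq> c v}"
  have AB: "verts G = A \<union> B" "A \<inter> B = {}" "v \<in> B" using v by (auto simp: A_def B_def)
  have fin: "finite A" "finite B" using G(4) AB by auto
  from adj show ?thesis
  proof
    assume bip: ?bipartite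
    have "(u, w) \<in> arcs_ends G \<longleftrightarrow> w \<in> A" if u: "u \<in> B" for u w
    proof -
      have "(u, w) \<in> arcs_ends G \<longleftrightarrow> w \<in> verts G \<and> u \<noteq> w \<and> c u \<noteq> c w"
        using G(3)[of u w] bip u unfolding B_def by blast
      then show ?thesis using u unfolding A_def B_def by auto
    qed
    then have "{w. (u, w) \<in> arcs_ends G} = A" if "u \<in> B" for u using that by blast
    then show ?thesis
      using AB by (intro complete_bipartiteI_common_neighbours[of A B]) auto
  next
    assume cl: ?cliques
    have cl': "{w. (u, w) \<in> arcs_ends G} = {w \<in> verts G. c w = c u} - {u}" if u: "u \<in> verts G" for u
    proof -
      have "(u, w) \<in> arcs_ends G \<longleftrightarrow> (w \<in> verts G \<and> c w = c u) \<and> w \<noteq> u" for w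
        using G(3)[of u w] cl u by metis
      then have "{w. (u, w) \<in> arcs_ends G} = {w. (w \<in> verts G \<and> c w = c u) \<and> w \<noteq> u}"
        by (rule Collect_cong)
      then show ?thesis by (simp only: set_diff_eq singleton_iff mem_Collect_eq)
    qed
    have "{w. (v, w) \<in> arcs_ends G} = B - {v}" unfolding B_def by (rule cl'[OF v])
    then have "card B = r + 1" using G(2)[OF v] card_Suc_Diff1[OF fin(2) AB(3)] by simp
    then have A: "card A = r - 1" using card card_Un_disjoint[OF fin AB(2)] AB(1) by simp
    then have "A \<noteq> {}" using r by (intro notI) simp
    then obtain u where u: "u \<in> A" by blast
    have "{w \<in> verts G. c w = c u} = A"
    proof -
      have uv: "u \<in> verts G" "c u \<noteq> c v" using u by (auto simp: A_def)
      have "w \<in> verts G \<and> c w = c u \<longleftrightarrow> w \<in> verts G \<and> c w \<noteq> c v" for w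
        using c[of w] c[OF uv(1)] c[OF v] uv(2) unfolding insert_iff empty_iff by metis
      then show ?thesis unfolding A_def by (rule Collect_cong)
    qed
    then have "{w. (u, w) \<in> arcs_ends G} = A - {u}" using cl'[of u] u AB(1) by blast
    then have "card (A - {u}) = r" using G(2)[of u] u by (simp add: A_def)
    then show ?thesis using A card_Suc_Diff1[OF fin(1) u] by simp
  qed
qed

end

section \<open>Seidel matrices of regular graphs\<close>

context
  fixes G :: "('a, 'b) pre_digraph" and vs :: "'a list" and n :: nat
  assumes G: "graph G" and vs: "distinct vs" "set vs = verts G" "length vs = n"
begin

lemma seidel_matrix_entries:
  shows "seidel_matrix G vs \<in> carrier_mat n n"
    and "i < n \<Longrightarrow> seidel_matrix G vs $$ (i,i) = 0"
    and "i < n \<Longrightarrow> j < n \<Longrightarrow> i \<noteq> j \<Longrightarrow>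
      seidel_matrix G vs $$ (i,j) = (if (vs ! i, vs ! j) \<in> arcs_ends G then -1 else 1)"
  using vs by (auto simp: seidel_matrix_def)

lemma abs_seidel_matrix_off_diag:
  "i < n \<Longrightarrow> j < n \<Longrightarrow> i \<noteq> j \<Longrightarrow> \<bar>seidel_matrix G vs $$ (i,j)\<bar> = 1"
  by (simp add: seidel_matrix_entries)

lemma seidel_matrix_symmetric:
  assumes "i < n" "j < n"
  shows "seidel_matrix G vs $$ (i,j) = seidel_matrix G vs $$ (j,i)"
proof -
  interpret graph G by (rule G)
  have "(vs ! i, vs ! j) \<in> arcs_ends G \<longleftrightarrow> (vs ! j, vs ! i) \<in> arcs_ends G"
    using arcs_ends_symmetric[OF sym_arcs] by blast
  then show ?thesis using assms by (cases "i = j") (simp_all add: seidel_matrix_entries)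
qed

lemma seidel_spectrum:
  defines "M \<equiv> proots (char_poly (seidel_matrix G vs))"
  shows "real (size M) = (real n - 1) + 1"
    and "(\<Sum>x\<in>#M. x) = 0"
    and "(\<Sum>x\<in>#M. x^2) = (real n - 1) * ((real n - 1) + 1)"
    and "x \<in># M \<longleftrightarrow> eigenvalue (seidel_matrix G vs) x"
    and "x \<in># M \<Longrightarrow> \<bar>x\<bar> \<le> real n - 1"
proof -
  note S = seidel_matrix_entries(1)
  note spec = symmetric_real_mat_spectrum[OF S seidel_matrix_symmetric, folded M_def]
  show "real (size M) = (real n - 1) + 1" using spec(1) by simp
  show "(\<Sum>x\<in>#M. x) = 0" using spec(2) by (simp add: seidel_matrix_entries(2))
  show "(\<Sum>x\<in>#M. x^2) = (real n - 1) * ((real n - 1) + 1)"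
    using spec(3) sum_entries_sq[OF S seidel_matrix_entries(2) abs_seidel_matrix_off_diag] by simp
  show ev: "x \<in># M \<longleftrightarrow> eigenvalue (seidel_matrix G vs) x" by (rule spec(4))
  show "x \<in># M \<Longrightarrow> \<bar>x\<bar> \<le> real n - 1"
    using abs_eigenvalue_le[OF S seidel_matrix_entries(2) abs_seidel_matrix_off_diag] ev by blast
qed

lemma complete_bipartite_seidel_eigenvalue:
  assumes K: "complete_bipartite_digraph a b G" and "n > 0"
  shows "eigenvalue (seidel_matrix G vs) (real n - 1)"
proof -
  obtain U V where UV: "verts G = U \<union> V" "U \<inter> V = {}" "arcs_ends G = U \<times> V \<union> V \<times> U"
    using K unfolding complete_bipartite_digraph_def by blast
  define s :: "nat \<Rightarrow> real" where "s i = (if vs ! i \<in> U then 1 else -1)" for i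
  show ?thesis
  proof (rule rank_one_eigenvalue[OF seidel_matrix_entries(1,2) abs_seidel_matrix_off_diag])
    fix i j assume ij: "i < n" "j < n" "i \<noteq> j"
    have "vs ! i \<in> U \<union> V" "vs ! j \<in> U \<union> V" using ij vs UV(1) by (metis nth_mem)+
    then show "seidel_matrix G vs $$ (i,j) = s i * s j"
      unfolding seidel_matrix_entries(3)[OF ij] s_def UV(3) using UV(2) by auto
  qed (use \<open>n > 0\<close> in \<open>auto simp: s_def\<close>)
qed

text \<open>
  The sign vector belonging to the extremal eigenvalue is a colouring with two colours \<open>1\<close> and \<open>-1\<close>;
  the sign \<open>\<epsilon>\<close> decides whether adjacent vertices have different or equal colours.
\<close>
lemma complete_bipartite_if_extremal_eigenvalue:
  assumes reg: "regular_graph r G" and n: "n = 2 * r" and r: "r \<ge> 2"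
    and x: "eigenvalue (seidel_matrix G vs) x" "\<bar>x\<bar> = real n - 1"
  shows "complete_bipartite_digraph r r G"
proof -
  obtain \<epsilon> :: real and s :: "nat \<Rightarrow> real" where \<epsilon>: "\<bar>\<epsilon>\<bar> = 1" and s: "\<forall>i<n. \<bar>s i\<bar> = 1"
    and Ss: "\<forall>i<n. \<forall>j<n. i \<noteq> j \<longrightarrow> seidel_matrix G vs $$ (i,j) = \<epsilon> * s i * s j"
    by (rule extremal_eigenvalue_rank_one[OF seidel_matrix_entries(1,2) abs_seidel_matrix_off_diag x])
  define c where "c u = s (inv_into {..<n} ((!) vs) u)" for u
  have "inj_on ((!) vs) {..<n}" using vs by (intro inj_on_nth) auto
  then have c: "c (vs ! i) = s i" if "i < n" for i using that by (simp add: c_def)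
  have index: "\<exists>i<n. u = vs ! i" if "u \<in> verts G" for u
    using that vs by (metis in_set_conv_nth)
  have c1: "c u \<in> {1, -1}" if u: "u \<in> verts G" for u
  proof -
    obtain i where "i < n" "u = vs ! i" using index[OF u] by blast
    then show ?thesis using c[of i] s by (auto simp: abs_if split: if_splits)
  qed
  have adj: "(u, w) \<in> arcs_ends G \<longleftrightarrow> \<epsilon> * c u * c w = -1"
    if uw: "u \<in> verts G" "w \<in> verts G" "u \<noteq> w" for u w
  proof -
    obtain i j where ij: "i < n" "u = vs ! i" "j < n" "w = vs ! j" using index uw by metis
    then have "i \<noteq> j" using uw(3) by auto
    then have "seidel_matrix G vs $$ (i,j) = \<epsilon> * c u * c w" using Ss ij c by simp
    then show ?thesis
      using seidel_matrix_entries(3)[OF ij(1,3) \<open>i \<noteq> j\<close>] ij(2,4) by (auto split: if_splits)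
  qed
  have card: "card (verts G) = 2 * r" using vs n distinct_card by metis
  show ?thesis
  proof (rule complete_bipartite_if_two_coloured[OF reg card r _ c1])
    consider "\<epsilon> = 1" | "\<epsilon> = -1" using \<epsilon> by linarith
    then show "(\<forall>u\<in>verts G. \<forall>w\<in>verts G. u \<noteq> w \<longrightarrow> ((u, w) \<in> arcs_ends G \<longleftrightarrow> c u \<noteq> c w)) \<or>
       (\<forall>u\<in>verts G. \<forall>w\<in>verts G. u \<noteq> w \<longrightarrow> ((u, w) \<in> arcs_ends G \<longleftrightarrow> c u = c w))"
    proof cases
      case 1
      have "(u, w) \<in> arcs_ends G \<longleftrightarrow> c u \<noteq> c w" if "u \<in> verts G" "w \<in> verts G" "u \<noteq> w" for u w
        using adj[OF that] c1[OF that(1)] c1[OF that(2)] 1 by auto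
      then show ?thesis by blast
    next
      case 2
      have "(u, w) \<in> arcs_ends G \<longleftrightarrow> c u = c w" if "u \<in> verts G" "w \<in> verts G" "u \<noteq> w" for u w
        using adj[OF that] c1[OF that(1)] c1[OF that(2)] 2 by auto
      then show ?thesis by blast
    qed
  qed
qed

end

theorem theorem4p9:
  fixes G :: "('a, 'b) pre_digraph" and vs :: "'a list" and r n :: nat and p :: real
  assumes "r \<ge> 1"
    and "regular_graph r G"
    and "n = 2 * r" and "card (verts G) = n"
    and "distinct vs" and "set vs = verts G"
    and "p \<ge> 3"
  shows "seidel_energy p G vs \<le> (real n - 1) powr p + (real n - 1)
    \<and> (seidel_energy p G vs = (real n - 1) powr p + (real n - 1)
        \<longleftrightarrow> complete_bipartite_digraph r r G)"
proof -
  have G: "graph G" using assms(2) by (simp add: regular_graph_def)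
  have len: "length vs = n" using distinct_card[OF assms(5)] assms(4,6) by simp
  note spec = seidel_spectrum[OF G assms(5,6) len]
  show ?thesis
  proof (cases "complete_bipartite_digraph r r G")
    case True
    have "eigenvalue (seidel_matrix G vs) (real n - 1)"
      using complete_bipartite_seidel_eigenvalue[OF G assms(5,6) len True] assms(1,3) by simp
    then have "seidel_energy p G vs = (real n - 1) powr p + (real n - 1)"
      unfolding seidel_energy_def using assms(1,3)
      by (intro power_sum_rank_one_spectrum[OF spec(1) _ spec(2,3)]) (simp_all add: spec(4))
    with True show ?thesis by simp
  next
    case False
    have "\<not> r \<le> 2"
      using complete_bipartite_if_small[of r G] assms(1-4) False by blast
    then have r: "r \<ge> 3" by simp
    have less: "\<bar>x\<bar> < real n - 1" if x: "x \<in># proots (char_poly (seidel_matrix G vs))" for x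
      using complete_bipartite_if_extremal_eigenvalue[OF G assms(5,6) len assms(2,3)]
        False r spec(4)[of x] spec(5)[OF x] x by force
    have N: "real n - 1 \<ge> 5" using r assms(3) by simp
    have "seidel_energy p G vs < (real n - 1) powr p + (real n - 1)"
      unfolding seidel_energy_def
      using N spec(5) abs_cube_sum_less[OF N spec(1-3) less]
      by (intro power_sum_less_from_cubic[OF _ assms(7) spec(1,3)]) auto
    with False show ?thesis by simp
  qed
qed

end
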